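(* Let $n\ge2$ and let $\mathfrak{L}$ be a complex semisimple finite-dimensional $n$-Lie algebra. Then there are no non-trivial transposed Poisson $n$-Lie algebra structures defined on $\mathfrak{L}$.
   Context: An $n$-Lie (Filippov) algebra is a vector space $\mathfrak{L}$ with an $n$-linear skew-symmetric bracket $[\;,\ldots,\;]$ satisfying $[x_1,\ldots,x_{n-1},[y_1,\ldots,y_n]]=\sum_{i=1}^n[y_1,\ldots,[x_1,\ldots,x_{n-1},y_i],\ldots,y_n]$. Complex semisimple finite-dimensional $n$-Lie algebras are exactly the finite direct sums of simple ones (simple: nonzero bracket and no proper nonzero ideals). A transposed Poisson $n$-Lie algebra structure on $\mathfrak{L}$ is a commutative associative (not necessarily unital) bilinear operation $\cdot$ on $\mathfrak{L}$ such that $n\,w\cdot[x_1,\ldots,x_n]=\sum_{i=1}^n[x_1,\ldots,w\cdot x_i,\ldots,x_n]$ for all $w,x_1,\ldots,x_n\in\mathfrak{L}$. The structure is non-trivial if both $\cdot$ and $[\;,\ldots,\;]$ are not identically zero. *)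

theory Defs
  imports Complex_Main "HOL-Library.FuncSet"
begin

text \<open>An \<open>n\<close>-ary bracket is a function on lists; only its values on lists of length \<open>n\<close> matter.\<close>

locale n_lie_algebra = vector_space scale
  for scale :: "complex \<Rightarrow> 'a::ab_group_add \<Rightarrow> 'a" (infixr \<open>*s\<close> 75) +
  fixes n :: nat and br :: "'a list \<Rightarrow> 'a"
  assumes multilinear:
      "\<And>xs i. length xs = n \<Longrightarrow> i < n \<Longrightarrow> Vector_Spaces.linear (*s) (*s) (\<lambda>v. br (xs[i := v]))"
    and skew_symmetric:
      "\<And>xs i j. length xs = n \<Longrightarrow> i < j \<Longrightarrow> j < n \<Longrightarrow> br (xs[i := xs ! j, j := xs ! i]) = - br xs"
    and filippov:
      "\<And>xs ys. length xs = n - 1 \<Longrightarrow> length ys = n \<Longrightarrow>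
        br (xs @ [br ys]) = (\<Sum>i<n. br (ys[i := br (xs @ [ys ! i])]))"
begin

definition nlie_ideal :: "'a set \<Rightarrow> 'a set \<Rightarrow> bool"
  where "nlie_ideal S I \<longleftrightarrow> subspace I \<and> I \<subseteq> S \<and>
    (\<forall>xs. length xs = n \<and> set xs \<subseteq> S \<and> (\<exists>i<n. xs ! i \<in> I) \<longrightarrow> br xs \<in> I)"

text \<open>Simplicity of \<open>S\<close> as an \<open>n\<close>-Lie algebra in its own right: the ideals considered are those of \<open>S\<close>,
  not those of the ambient algebra. Meant for \<open>S\<close> a subalgebra.\<close>

definition nlie_simple :: "'a set \<Rightarrow> bool"
  where "nlie_simple S \<longleftrightarrow>
    (\<exists>xs. length xs = n \<and> set xs \<subseteq> S \<and> br xs \<noteq> 0) \<and>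
    (\<forall>I. nlie_ideal S I \<longrightarrow> I = {0} \<or> I = S)"

text \<open>The algebra is the direct sum of finitely many simple \<open>n\<close>-Lie algebras. The summands are ideals of the
  whole algebra, which forces brackets mixing different summands to vanish, so that the bracket
  is the componentwise one. The empty sum (the zero algebra) is admitted.\<close>

definition nlie_semisimple :: bool
  where "nlie_semisimple \<longleftrightarrow> (\<exists>(m::nat) S.
    (\<forall>k<m. nlie_ideal UNIV (S k) \<and> nlie_simple (S k)) \<and>
    (\<forall>v. \<exists>!f. f \<in> (\<Pi>\<^sub>E k\<in>{..<m}. S k) \<and> v = (\<Sum>k<m. f k)))"

definition transposed_poisson :: "('a \<Rightarrow> 'a \<Rightarrow> 'a) \<Rightarrow> bool"
  where "transposed_poisson mul \<longleftrightarrow>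
    (\<forall>x. Vector_Spaces.linear (*s) (*s) (\<lambda>y. mul x y)) \<and>
    (\<forall>y. Vector_Spaces.linear (*s) (*s) (\<lambda>x. mul x y)) \<and>
    (\<forall>x y. mul x y = mul y x) \<and>
    (\<forall>x y z. mul (mul x y) z = mul x (mul y z)) \<and>
    (\<forall>w xs. length xs = n \<longrightarrow>
       of_nat n *s mul w (br xs) = (\<Sum>i<n. br (xs[i := mul w (xs ! i)])))"

definition nontrivial_structure :: "('a \<Rightarrow> 'a \<Rightarrow> 'a) \<Rightarrow> bool"
  where "nontrivial_structure mul \<longleftrightarrow>
    (\<exists>x y. mul x y \<noteq> 0) \<and> (\<exists>xs. length xs = n \<and> br xs \<noteq> 0)"

end

end

theory Submission
  imports Defs "HOL-Computational_Algebra.Fundamental_Theorem_Algebra"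
begin

text \<open>
  Write \<open>\<Delta>\<^sub>k\<close> for the set of linear maps \<open>f\<close> with
  \<open>n\<^sup>k f [x\<^sub>1, \<dots>, x\<^sub>n] = \<Sum>\<^sub>i [x\<^sub>1, \<dots>, f x\<^sub>i, \<dots>, x\<^sub>n]\<close>. The derivations are
  \<open>\<Delta>\<^sub>0\<close>, and the multiplications \<open>v \<mapsto> w \<cdot> v\<close> of a transposed Poisson structure lie in \<open>\<Delta>\<^sub>1\<close>.
  The heart of the proof is that on a simple algebra \<open>S\<close> every member of \<open>\<Delta>\<^sub>k\<close>, \<open>k \<ge> 1\<close>, is a scalar.
  This rests on two facts.

  First, the commutators satisfy \<open>[\<Delta>\<^sub>j, \<Delta>\<^sub>k] \<subseteq> \<Delta>\<^bsub>j+k\<^esub>\<close>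
  (\<open>scaled_derivation_commutator\<close>). In particular \<open>\<Delta>\<^sub>0\<close> normalises each \<open>\<Delta>\<^sub>k\<close>, and a subspace
  stable under \<open>\<Delta>\<^sub>0\<close> is an ideal, because by the Filippov identity the inner maps
  \<open>v \<mapsto> [z\<^sub>1, \<dots>, z\<^bsub>n-1\<^esub>, v]\<close> are derivations.

  Second, \<open>\<Delta>\<^sub>k = 0\<close> on \<open>S\<close> for all large \<open>k\<close> (\<open>scaled_derivation_large_power\<close>): brackets span \<open>S\<close>, so the
  defining equation bounds \<open>n\<^sup>k\<close> times the size of \<open>f\<close> by a constant times the size of \<open>f\<close>.

  These are combined by descent from \<open>\<Delta>\<^bsub>2k\<^esub>\<close> to \<open>\<Delta>\<^sub>k\<close>. If \<open>\<Delta>\<^bsub>2k\<^esub>\<close> consists of scalars then it is zero, as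
  comparing \<open>n\<^bsup>2k\<^esup> c\<close> with \<open>n c\<close> shows; hence \<open>\<Delta>\<^sub>k\<close> is commutative.
  For a commutative \<open>\<Delta>\<^sub>k\<close>, generalised eigenspaces are ideals, so each member is a scalar plus a nilpotent
  map (\<open>eigenvalue_shift_nilpotent\<close>); commutators with derivations have eigenvalue \<open>0\<close>
  (\<open>commutator_singular\<close>); and therefore the common eigenvectors belonging to one system of eigenvalues form
  an ideal, which has to be all of \<open>S\<close> (\<open>commuting_scaled_derivations_scalar\<close>).

  On a simple summand we thus have \<open>w \<cdot> v = \<lambda>(w) v\<close>. Commutativity \<open>\<lambda>(w) v = \<lambda>(v) w\<close> would make the summand
  a line if some \<open>\<lambda>(w) \<noteq> 0\<close>, but a skew-symmetric bracket of at least two arguments vanishes on a line.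
  So the product is zero on each summand. Products of different summands lie in their intersection, which is
  zero.
\<close>

section \<open>Linear maps on a finite-dimensional complex space\<close>

locale complex_fd_space = finite_dimensional_vector_space scale Basis
  for scale :: "complex \<Rightarrow> 'a::ab_group_add \<Rightarrow> 'a" (infixr \<open>*s\<close> 75) and Basis :: "'a set"
begin

abbreviation lin :: "('a \<Rightarrow> 'a) \<Rightarrow> bool"
  where "lin \<equiv> Vector_Spaces.linear (*s) (*s)"

lemma linI:
  assumes "\<And>x y. f (x + y) = f x + f y" "\<And>c x. f (c *s x) = c *s f x"
  shows "lin f"
  using assms vector_space_axioms by (simp add: Vector_Spaces.linear_iff)

lemma
  assumes "lin f"
  shows lin_add: "f (x + y) = f x + f y"
    and lin_scale: "f (c *s x) = c *s f x"
    and lin_0: "f 0 = 0"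
    and lin_diff: "f (x - y) = f x - f y"
    and lin_sum: "f (sum g A) = (\<Sum>a\<in>A. f (g a))"
proof -
  interpret Vector_Spaces.linear scale scale f by fact
  show "f (x + y) = f x + f y" "f (c *s x) = c *s f x" "f 0 = 0" "f (x - y) = f x - f y"
    "f (sum g A) = (\<Sum>a\<in>A. f (g a))"
    by (rule add scale zero diff sum)+
qed

lemma lin_commutator:
  assumes "lin f" "lin g"
  shows "lin (\<lambda>x. f (g x) - g (f x))"
  by (rule linI) (simp_all add: assms lin_add lin_scale scale_right_diff_distrib)

lemma lin_shift:
  assumes "lin f"
  shows "lin (\<lambda>x. f x - c *s x)"
  by (rule linI) (simp_all add: assms lin_add lin_scale scale_right_diff_distrib
      scale_right_distrib mult.commute)

lemma lin_funpow:
  assumes "lin f"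
  shows "lin (f ^^ m)"
proof (induction m)
  case 0
  show ?case by (rule linI) simp_all
next
  case (Suc m)
  show ?case
    by (rule linI) (simp_all add: lin_add[OF Suc] lin_scale[OF Suc] lin_add[OF assms] lin_scale[OF assms])
qed

lemma funpow_invariant:
  assumes "f ` S \<subseteq> S" "x \<in> S"
  shows "(f ^^ m) x \<in> S"
  using assms by (induction m) auto

lemma lin_vanishes_on_span:
  assumes "lin f" "\<And>b. b \<in> B \<Longrightarrow> f b = 0" "x \<in> span B"
  shows "f x = 0"
  using assms(3)
  by (induction rule: span_induct_alt) (simp_all add: assms lin_add lin_scale lin_0)

lemma funpow_eigenvector:
  assumes "lin f" "f y = c *s y"
  shows "(f ^^ m) y = (c ^ m) *s y"
  by (induction m) (simp_all add: assms lin_scale mult.commute)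

definition poly_action :: "('a \<Rightarrow> 'a) \<Rightarrow> complex poly \<Rightarrow> 'a \<Rightarrow> 'a"
  where "poly_action f p v = (\<Sum>i\<le>degree p. coeff p i *s (f ^^ i) v)"

lemma poly_action_bound:
  assumes "degree p \<le> N"
  shows "poly_action f p v = (\<Sum>i\<le>N. coeff p i *s (f ^^ i) v)"
  unfolding poly_action_def using assms
  by (intro sum.mono_neutral_left) (auto simp: coeff_eq_0)

lemma poly_action_linear_factor:
  assumes "lin f"
  shows "poly_action f ([:- c, 1:] * q) v = f (poly_action f q v) - c *s poly_action f q v"
proof -
  let ?N = "degree q"
  have eq: "[:- c, 1:] * q = pCons 0 q - smult c q" by simp
  have "degree ([:- c, 1:] * q) \<le> Suc ?N"
    using degree_mult_le[of "[:- c, 1:]" q] by simp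
  then have "poly_action f ([:- c, 1:] * q) v
      = (\<Sum>i\<le>Suc ?N. coeff (pCons 0 q - smult c q) i *s (f ^^ i) v)"
    unfolding eq by (rule poly_action_bound)
  also have "\<dots> = (\<Sum>i\<le>Suc ?N. coeff (pCons 0 q) i *s (f ^^ i) v)
      - (\<Sum>i\<le>Suc ?N. c *s (coeff q i *s (f ^^ i) v))"
    by (simp add: scale_left_diff_distrib sum_subtractf del: sum.atMost_Suc)
  also have "(\<Sum>i\<le>Suc ?N. coeff (pCons 0 q) i *s (f ^^ i) v)
      = (\<Sum>i\<le>?N. coeff q i *s (f ^^ Suc i) v)"
    by (subst sum.atMost_Suc_shift) simp
  also have "\<dots> = f (poly_action f q v)"
    by (simp add: poly_action_def lin_sum[OF assms] lin_scale[OF assms])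
  also have "(\<Sum>i\<le>Suc ?N. c *s (coeff q i *s (f ^^ i) v)) = c *s poly_action f q v"
    by (subst poly_action_bound[of q "Suc ?N"]) (simp_all add: scale_sum_right del: sum.atMost_Suc)
  finally show ?thesis .
qed

lemma poly_action_in_subspace:
  assumes "subspace W" "f ` W \<subseteq> W" "v \<in> W"
  shows "poly_action f p v \<in> W"
  unfolding poly_action_def
  by (intro subspace_sum subspace_scale assms funpow_invariant[OF assms(2)])

text \<open>The vectors \<open>f\<^sup>i v\<close>, \<open>i \<le> dimension\<close>, are one too many to be independent. If two of them coincide,
  their difference is the required relation; otherwise the set they form is dependent.\<close>

lemma annihilating_poly_exists: "\<exists>p. p \<noteq> 0 \<and> poly_action f p v = 0"
proof -
  let ?d = "dimension" and ?g = "\<lambda>i. (f ^^ i) v"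
  have "\<exists>c. (\<exists>i\<le>?d. c i \<noteq> 0) \<and> (\<Sum>i\<le>?d. c i *s ?g i) = 0"
  proof (cases "inj_on ?g {..?d}")
    case True
    have "card (?g ` {..?d}) = Suc ?d" using card_image[OF True] by simp
    then have "dependent (?g ` {..?d})"
      using dim_subset_UNIV[of "?g ` {..?d}"] by (intro dependent_biggerset_general) simp
    then obtain u where u: "\<exists>w\<in>?g ` {..?d}. u w \<noteq> 0" "(\<Sum>w\<in>?g ` {..?d}. u w *s w) = 0"
      by (subst (asm) dependent_finite) auto
    then show ?thesis
      by (intro exI[of _ "\<lambda>i. u (?g i)"]) (auto simp: sum.reindex[OF True])
  next
    case False
    then obtain i j where ij: "i \<le> ?d" "j \<le> ?d" "i \<noteq> j" "?g i = ?g j"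
      by (auto simp: inj_on_def)
    define c :: "nat \<Rightarrow> complex" where "c l = (if l = i then 1 else 0) - (if l = j then 1 else 0)" for l
    have "(\<Sum>l\<le>?d. c l *s ?g l)
        = (\<Sum>l\<le>?d. if l = i then ?g l else 0) - (\<Sum>l\<le>?d. if l = j then ?g l else 0)"
      unfolding sum_subtractf[symmetric] by (intro sum.cong) (auto simp: c_def scale_left_diff_distrib)
    also have "\<dots> = 0" using ij by (simp add: sum.delta)
    finally show ?thesis using ij by (intro exI[of _ c]) (auto simp: c_def)
  qed
  then obtain c i where c: "i \<le> ?d" "c i \<noteq> 0" "(\<Sum>i\<le>?d. c i *s ?g i) = 0" by blast
  define p where "p = (\<Sum>i\<le>?d. monom (c i) i)"
  have co: "coeff p l = (if l \<le> ?d then c l else 0)" for l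
    by (simp add: p_def coeff_sum)
  have "p \<noteq> 0" using c co[of i] by auto
  moreover have "degree p \<le> ?d" by (rule degree_le) (simp add: co)
  then have "poly_action f p v = 0"
    by (subst poly_action_bound[of p ?d]) (use c(3) in \<open>auto simp: co\<close>)
  ultimately show ?thesis by blast
qed

text \<open>A linear factor of a polynomial that annihilates \<open>v\<close> either produces an eigenvector or can be
  cancelled. No nonzero constant annihilates \<open>v\<close>, so the cancelling stops.\<close>

lemma eigenvector_exists:
  assumes "lin f" "subspace W" "f ` W \<subseteq> W" "W \<noteq> {0}"
  shows "\<exists>y c. y \<in> W \<and> y \<noteq> 0 \<and> f y = c *s y"
proof -
  obtain v where v: "v \<in> W" "v \<noteq> 0" using assms(2,4) subspace_0 by blast
  obtain p0 where "p0 \<noteq> 0" "poly_action f p0 v = 0" using annihilating_poly_exists by blast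
  then show ?thesis
  proof (induction "degree p0" arbitrary: p0 rule: less_induct)
    case less
    show ?case
    proof (cases "degree p0 = 0")
      case True
      then obtain a where "p0 = [:a:]" using degree_eq_zeroE by blast
      with less.prems v show ?thesis by (simp add: poly_action_def)
    next
      case False
      then have "\<not> constant (poly p0)" by (simp add: constant_degree)
      then obtain c where "poly p0 c = 0" using fundamental_theorem_of_algebra by blast
      then obtain q where q: "p0 = [:- c, 1:] * q" by (auto simp: poly_eq_0_iff_dvd)
      with less.prems have "q \<noteq> 0" by auto
      then have deg: "degree q < degree p0" unfolding q by (subst degree_mult_eq) auto
      let ?w = "poly_action f q v"
      have "f ?w = c *s ?w"
        using less.prems(2) unfolding q poly_action_linear_factor[OF assms(1)] by simp
      then show ?thesis
        using less.hyps[OF deg \<open>q \<noteq> 0\<close>] poly_action_in_subspace[OF assms(2,3) v(1)] by blast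
    qed
  qed
qed

text \<open>On a nonzero invariant subspace of least dimension every member of the family is a scalar, as the
  eigenspaces in it are invariant again. Commutation is only asked for on \<open>S\<close>, since maps of the whole
  space may be controlled there only.\<close>

lemma common_eigenvector_exists:
  assumes lin: "\<And>f. f \<in> F \<Longrightarrow> lin f" and inv: "\<And>f. f \<in> F \<Longrightarrow> f ` S \<subseteq> S"
    and comm: "\<And>f g x. f \<in> F \<Longrightarrow> g \<in> F \<Longrightarrow> x \<in> S \<Longrightarrow> f (g x) = g (f x)"
    and S: "subspace S" "S \<noteq> {0}"
  shows "\<exists>x\<in>S. x \<noteq> 0 \<and> (\<forall>f\<in>F. \<exists>c. f x = c *s x)"
proof -
  define P where "P W \<longleftrightarrow> subspace W \<and> W \<subseteq> S \<and> W \<noteq> {0} \<and> (\<forall>f\<in>F. f ` W \<subseteq> W)" for W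
  have "P S" using S inv by (auto simp: P_def)
  then obtain W where W: "P W" and least: "\<And>V. P V \<Longrightarrow> dim W \<le> dim V"
    using ex_has_least_nat[of P S dim] by blast
  obtain x where x: "x \<in> W" "x \<noteq> 0" using W unfolding P_def using subspace_0 by blast
  have "\<exists>c. f x = c *s x" if f: "f \<in> F" for f
  proof -
    obtain y c where y: "y \<in> W" "y \<noteq> 0" "f y = c *s y"
      using eigenvector_exists[OF lin[OF f], of W] W f by (auto simp: P_def)
    let ?V = "{z \<in> W. f z = c *s z}"
    have sub: "subspace ?V"
      using W lin[OF f] unfolding P_def subspace_def
      by (simp add: lin_0 lin_add lin_scale scale_right_distrib mult.commute)
    have "P ?V"
      unfolding P_def
    proof (intro conjI ballI sub)
      show "?V \<subseteq> S" using W by (auto simp: P_def)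
      show "?V \<noteq> {0}" using y by blast
      fix g assume g: "g \<in> F"
      show "g ` ?V \<subseteq> ?V"
      proof (safe)
        fix z assume z: "z \<in> W" "f z = c *s z"
        then show "g z \<in> W" using W g by (auto simp: P_def)
        have "f (g z) = g (f z)" using comm[OF f g] z W by (auto simp: P_def)
        then show "f (g z) = c *s g z" using z lin_scale[OF lin[OF g]] by simp
      qed
    qed
    then have "?V = W"
      using least[of ?V] W sub by (intro subspace_dim_equal) (auto simp: P_def)
    with x show ?thesis by blast
  qed
  with x W show ?thesis by (auto simp: P_def)
qed

lemma uniformly_nilpotent:
  assumes "lin f" "subspace S" and nil: "\<And>x. x \<in> S \<Longrightarrow> \<exists>m. (f ^^ m) x = 0"
  shows "\<exists>M. \<forall>x\<in>S. (f ^^ M) x = 0"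
proof -
  obtain B where B: "finite B" "B \<subseteq> S" "span B = S" using basis_subspace_exists[OF assms(2)] .
  from nil B(2) have "\<forall>b\<in>B. \<exists>m. (f ^^ m) b = 0" by blast
  then obtain m where m: "\<And>b. b \<in> B \<Longrightarrow> (f ^^ m b) b = 0" by metis
  let ?M = "sum m B"
  have "(f ^^ ?M) b = 0" if "b \<in> B" for b
  proof -
    have "?M = (?M - m b) + m b" using member_le_sum[of b B m] that B by simp
    then have "(f ^^ ?M) b = (f ^^ (?M - m b)) ((f ^^ m b) b)" by (metis comp_apply funpow_add)
    also have "\<dots> = 0" using lin_0[OF lin_funpow[OF assms(1)]] m[OF that] by simp
    finally show ?thesis .
  qed
  then have "(f ^^ ?M) x = 0" if "x \<in> S" for x
    using lin_vanishes_on_span[OF lin_funpow[OF assms(1)]] B that by blast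
  then show ?thesis by blast
qed

text \<open>The Leibniz rule \<open>[g\<^bsup>m+1\<^esup>, D] = (m + 1) C g\<^sup>m\<close> for a commutator \<open>C = [g, D]\<close> that commutes
  with \<open>g\<close>.\<close>

lemma funpow_commutator:
  assumes "lin g" "g ` S \<subseteq> S"
    and C: "\<And>x. x \<in> S \<Longrightarrow> g (D x) = D (g x) + C x"
    and comm: "\<And>x. x \<in> S \<Longrightarrow> g (C x) = C (g x)"
    and x: "x \<in> S"
  shows "(g ^^ Suc m) (D x) = D ((g ^^ Suc m) x) + of_nat (Suc m) *s C ((g ^^ m) x)"
proof (induction m)
  case 0
  show ?case using C[OF x] by simp
next
  case (Suc m)
  have in_S: "(g ^^ k) x \<in> S" for k using funpow_invariant[OF assms(2) x] .
  have "(g ^^ Suc (Suc m)) (D x) = g (D ((g ^^ Suc m) x) + of_nat (Suc m) *s C ((g ^^ m) x))"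
    using Suc by simp
  also have "\<dots> = g (D ((g ^^ Suc m) x)) + of_nat (Suc m) *s g (C ((g ^^ m) x))"
    by (simp only: lin_add[OF assms(1)] lin_scale[OF assms(1)])
  also have "\<dots> = D ((g ^^ Suc (Suc m)) x) + C ((g ^^ Suc m) x) + of_nat (Suc m) *s C ((g ^^ Suc m) x)"
    by (simp only: C[OF in_S] comm[OF in_S]) simp
  also have "\<dots> = D ((g ^^ Suc (Suc m)) x) + of_nat (Suc (Suc m)) *s C ((g ^^ Suc m) x)"
    using scale_left_distrib[of 1 "of_nat (Suc m)" "C ((g ^^ Suc m) x)"]
    by (simp only: of_nat_Suc[of "Suc m"] scale_one add.assoc)
  finally show ?case .
qed

text \<open>The \<open>\<ell>\<^sup>1\<close> norm of the coordinates.\<close>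

definition nrm :: "'a \<Rightarrow> real"
  where "nrm v = (\<Sum>b\<in>Basis. cmod (representation Basis v b))"

lemma nrm_nonneg: "nrm v \<ge> 0"
  unfolding nrm_def by (simp add: sum_nonneg)

lemma nrm_add: "nrm (u + v) \<le> nrm u + nrm v"
proof -
  have "representation Basis (u + v) b = representation Basis u b + representation Basis v b" for b
    using representation_add[OF independent_Basis] by (simp add: span_Basis)
  then show ?thesis
    unfolding nrm_def sum.distrib[symmetric] by (intro sum_mono) (simp add: norm_triangle_ineq)
qed

lemma nrm_scale: "nrm (c *s v) = cmod c * nrm v"
proof -
  have "representation Basis (c *s v) b = c * representation Basis v b" for b
    using representation_scale[OF independent_Basis] by (simp add: span_Basis)
  then show ?thesis
    unfolding nrm_def sum_distrib_left by (simp add: norm_mult)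
qed

lemma nrm_0: "nrm 0 = 0"
  using nrm_scale[of 0 0] by simp

lemma nrm_sum: "nrm (sum f A) \<le> (\<Sum>a\<in>A. nrm (f a))"
proof (induction A rule: infinite_finite_induct)
  case (insert a A)
  then show ?case using nrm_add[of "f a" "sum f A"] by simp
qed (simp_all add: nrm_0)

lemma representation_Basis_sum: "(\<Sum>b\<in>Basis. representation Basis v b *s b) = v"
  using sum_representation_eq[OF independent_Basis _ finite_Basis] by (simp add: span_Basis)

lemma nrm_eq_0: "nrm v = 0 \<Longrightarrow> v = 0"
proof -
  assume "nrm v = 0"
  then have "\<forall>b\<in>Basis. representation Basis v b = 0"
    unfolding nrm_def by (subst (asm) sum_nonneg_eq_0_iff) (auto simp: finite_Basis)
  then show "v = 0" using representation_Basis_sum[of v] by simp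
qed

lemma lin_bounded:
  assumes "lin f"
  shows "\<exists>C\<ge>0. \<forall>v. nrm (f v) \<le> C * nrm v"
proof (intro exI conjI allI)
  let ?C = "\<Sum>b\<in>Basis. nrm (f b)"
  show "0 \<le> ?C" by (simp add: sum_nonneg nrm_nonneg)
  fix v
  have "f v = (\<Sum>b\<in>Basis. representation Basis v b *s f b)"
    by (subst representation_Basis_sum[of v, symmetric])
      (simp add: lin_sum[OF assms] lin_scale[OF assms])
  then have "nrm (f v) \<le> (\<Sum>b\<in>Basis. cmod (representation Basis v b) * nrm (f b))"
    using nrm_sum[of "\<lambda>b. representation Basis v b *s f b" Basis] by (simp add: nrm_scale)
  also have "\<dots> \<le> (\<Sum>b\<in>Basis. nrm v * nrm (f b))"
  proof (intro sum_mono mult_right_mono nrm_nonneg)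
    fix b assume "b \<in> Basis"
    then show "cmod (representation Basis v b) \<le> nrm v"
      unfolding nrm_def by (intro member_le_sum) (auto simp: finite_Basis)
  qed
  also have "\<dots> = ?C * nrm v" by (simp add: sum_distrib_left mult.commute)
  finally show "nrm (f v) \<le> ?C * nrm v" .
qed

text \<open>The constant depends on the vector only, so the values on a basis measure the size of all linear maps
  at once.\<close>

lemma nrm_bounded_on_span:
  assumes "finite B" "v \<in> span B"
  shows "\<exists>C\<ge>0. \<forall>f. lin f \<longrightarrow> nrm (f v) \<le> C * (\<Sum>b\<in>B. nrm (f b))"
  using assms(2)
proof (induction rule: span_induct_alt)
  case base
  show ?case by (intro exI[of _ 0]) (simp add: lin_0 nrm_0)
next
  case (step c x y)
  then obtain C where C: "C \<ge> 0" "\<And>f. lin f \<Longrightarrow> nrm (f y) \<le> C * (\<Sum>b\<in>B. nrm (f b))" by blast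
  show ?case
  proof (intro exI[of _ "cmod c + C"] conjI allI impI)
    show "0 \<le> cmod c + C" using C by simp
    fix f assume f: "lin f"
    have "nrm (f (c *s x + y)) \<le> cmod c * nrm (f x) + nrm (f y)"
      using nrm_add[of "c *s f x" "f y"] by (simp add: f lin_add lin_scale nrm_scale)
    also have "\<dots> \<le> cmod c * (\<Sum>b\<in>B. nrm (f b)) + C * (\<Sum>b\<in>B. nrm (f b))"
      using C(2)[OF f] step(1) assms(1)
      by (intro add_mono mult_left_mono member_le_sum) (auto simp: nrm_nonneg)
    finally show "nrm (f (c *s x + y)) \<le> (cmod c + C) * (\<Sum>b\<in>B. nrm (f b))"
      by (simp add: distrib_right)
  qed
qed

end

section \<open>Derivations scaled by powers of n\<close>

locale fd_n_lie_algebra = n_lie_algebra scale n br + complex_fd_space scale Basis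
  for scale :: "complex \<Rightarrow> 'a::ab_group_add \<Rightarrow> 'a" (infixr \<open>*s\<close> 75)
    and n :: nat and br :: "'a list \<Rightarrow> 'a" and Basis :: "'a set" +
  assumes n_ge_2: "2 \<le> n"
begin

text \<open>The maps \<open>\<Delta>\<^sub>k\<close> of the introduction, relative to a subspace \<open>S\<close>. They are defined on the whole space,
  which keeps linearity unrelativised, but two of them are only compared on \<open>S\<close>.\<close>

definition scaled_derivation :: "'a set \<Rightarrow> nat \<Rightarrow> ('a \<Rightarrow> 'a) \<Rightarrow> bool"
  where "scaled_derivation S k f \<longleftrightarrow> lin f \<and> f ` S \<subseteq> S \<and>
    (\<forall>xs. length xs = n \<and> set xs \<subseteq> S \<longrightarrow>
      (of_nat n ^ k) *s f (br xs) = (\<Sum>i<n. br (xs[i := f (xs ! i)])))"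

lemma scaled_derivationD:
  assumes "scaled_derivation S k f"
  shows "lin f" "f ` S \<subseteq> S" "x \<in> S \<Longrightarrow> f x \<in> S"
    and "length xs = n \<Longrightarrow> set xs \<subseteq> S \<Longrightarrow>
      (of_nat n ^ k) *s f (br xs) = (\<Sum>i<n. br (xs[i := f (xs ! i)]))"
  using assms by (auto simp: scaled_derivation_def)

lemma set_update_subset: "set xs \<subseteq> S \<Longrightarrow> v \<in> S \<Longrightarrow> set (xs[i := v]) \<subseteq> S"
  using set_update_subset_insert[of xs i v] by blast

text \<open>Expanding \<open>n\<^bsup>j+k\<^esup> f (g [xs])\<close> gives a double sum over the slots hit by \<open>g\<close> and by \<open>f\<close>. Terms with two
  different slots are symmetric in \<open>f\<close> and \<open>g\<close> and cancel; the diagonal terms form the commutator.\<close>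

lemma scaled_derivation_commutator:
  assumes f: "scaled_derivation S j f" and g: "scaled_derivation S k g" and S: "subspace S"
  shows "scaled_derivation S (j + k) (\<lambda>x. f (g x) - g (f x))"
  unfolding scaled_derivation_def
proof (intro conjI allI impI)
  note lf = scaled_derivationD(1)[OF f] and lg = scaled_derivationD(1)[OF g]
  show "lin (\<lambda>x. f (g x) - g (f x))" using lf lg by (rule lin_commutator)
  show "(\<lambda>x. f (g x) - g (f x)) ` S \<subseteq> S"
    using scaled_derivationD(3)[OF f] scaled_derivationD(3)[OF g] S
    by (auto intro!: subspace_diff)
  fix xs :: "'a list" assume "length xs = n \<and> set xs \<subseteq> S"
  then have len: "length xs = n" and sub: "set xs \<subseteq> S" by auto
  have nth: "xs ! i \<in> S" if "i < n" for i using that len sub by auto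
  \<comment> \<open>the term of p (q [xs]) where q hits slot i and p then hits slot l\<close>
  define G where "G p q i l = br ((xs[i := q (xs ! i)])[l := p ((xs[i := q (xs ! i)]) ! l)])"
    for p q :: "'a \<Rightarrow> 'a" and i l
  have expand: "(of_nat n ^ (a + b)) *s p (q (br xs)) = (\<Sum>i<n. \<Sum>l<n. G p q i l)"
    if p: "scaled_derivation S a p" and q: "scaled_derivation S b q" for a b p q
  proof -
    note lp = scaled_derivationD(1)[OF p]
    have "(of_nat n ^ (a + b)) *s p (q (br xs)) = (of_nat n ^ a) *s p ((of_nat n ^ b) *s q (br xs))"
      by (simp add: lin_scale[OF lp] power_add)
    also have "\<dots> = (\<Sum>i<n. (of_nat n ^ a) *s p (br (xs[i := q (xs ! i)])))"
      by (simp add: scaled_derivationD(4)[OF q len sub] lin_sum[OF lp] scale_sum_right)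
    also have "\<dots> = (\<Sum>i<n. \<Sum>l<n. G p q i l)"
      unfolding G_def
      by (intro sum.cong refl scaled_derivationD(4)[OF p] set_update_subset sub
          scaled_derivationD(3)[OF q] nth) (simp_all add: len)
    finally show ?thesis .
  qed
  have off_diagonal: "G f g i l - G g f l i = 0" if "i < n" "l < n" "i \<noteq> l" for i l
    using that by (simp add: G_def len list_update_swap)
  have diagonal: "G f g i i - G g f i i = br (xs[i := f (g (xs ! i)) - g (f (xs ! i))])"
    if "i < n" for i
    using that lin_diff[OF multilinear[OF len that]] by (simp add: G_def len)
  have "(of_nat n ^ (j + k)) *s (f (g (br xs)) - g (f (br xs)))
      = (\<Sum>i<n. \<Sum>l<n. G f g i l) - (\<Sum>i<n. \<Sum>l<n. G g f i l)"
    using expand[OF f g] expand[OF g f]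
    by (simp add: scale_right_diff_distrib add.commute[of k j])
  also have "(\<Sum>i<n. \<Sum>l<n. G g f i l) = (\<Sum>i<n. \<Sum>l<n. G g f l i)" by (rule sum.swap)
  also have "(\<Sum>i<n. \<Sum>l<n. G f g i l) - (\<Sum>i<n. \<Sum>l<n. G g f l i)
      = (\<Sum>i<n. \<Sum>l<n. G f g i l - G g f l i)"
    by (simp add: sum_subtractf)
  also have "\<dots> = (\<Sum>i<n. \<Sum>l<n. if l = i then G f g i i - G g f i i else 0)"
    using off_diagonal by (intro sum.cong refl) auto
  also have "\<dots> = (\<Sum>i<n. br (xs[i := f (g (xs ! i)) - g (f (xs ! i))]))"
    using diagonal by (intro sum.cong refl) (simp add: sum.delta)
  finally show "(of_nat n ^ (j + k)) *s (f (g (br xs)) - g (f (br xs))) = \<dots>" .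
qed

end

section \<open>Scaled derivations of a simple algebra\<close>

locale simple_subalgebra = fd_n_lie_algebra scale n br Basis
  for scale :: "complex \<Rightarrow> 'a::ab_group_add \<Rightarrow> 'a" (infixr \<open>*s\<close> 75)
    and n :: nat and br :: "'a list \<Rightarrow> 'a" and Basis :: "'a set" +
  fixes S :: "'a set"
  assumes S_subspace: "subspace S"
    and br_closed: "length xs = n \<Longrightarrow> set xs \<subseteq> S \<Longrightarrow> br xs \<in> S"
    and simple: "nlie_simple S"
begin

lemma nonzero_bracket: "\<exists>xs. length xs = n \<and> set xs \<subseteq> S \<and> br xs \<noteq> 0"
  using simple by (simp add: nlie_simple_def)

lemma S_nonzero: "S \<noteq> {0}"
  using nonzero_bracket br_closed by blast

lemma inner_derivation:
  assumes len: "length zs = n - 1" and sub: "set zs \<subseteq> S"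
  shows "scaled_derivation S 0 (\<lambda>v. br (zs @ [v]))"
  unfolding scaled_derivation_def
proof (intro conjI allI impI)
  have "(zs @ [0])[n - 1 := v] = zs @ [v]" for v
    using len by (simp add: list_update_append)
  moreover have "lin (\<lambda>v. br ((zs @ [0])[n - 1 := v]))"
    using n_ge_2 len by (intro multilinear) auto
  ultimately show "lin (\<lambda>v. br (zs @ [v]))" by (simp only:)
  show "(\<lambda>v. br (zs @ [v])) ` S \<subseteq> S"
    using n_ge_2 len sub by (auto intro!: br_closed)
qed (use filippov len in simp)

text \<open>Stability under inner derivations is the ideal property for an entry in the last slot; skew-symmetry
  moves any other entry there. Hence a simple algebra is irreducible under its derivations.\<close>

lemma ideal_eq_S:
  assumes I: "subspace I" "I \<subseteq> S" "I \<noteq> {0}"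
    and inv: "\<And>D v. scaled_derivation S 0 D \<Longrightarrow> v \<in> I \<Longrightarrow> D v \<in> I"
  shows "I = S"
proof -
  have last: "br xs \<in> I" if "length xs = n" "set xs \<subseteq> S" "xs ! (n - 1) \<in> I" for xs
  proof -
    have "xs \<noteq> []" using that n_ge_2 by auto
    then have "xs = butlast xs @ [xs ! (n - 1)]"
      using that by (metis append_butlast_last_id last_conv_nth)
    moreover have "br (butlast xs @ [xs ! (n - 1)]) \<in> I"
      using that by (intro inv[OF inner_derivation]) (auto dest: in_set_butlastD)
    ultimately show ?thesis by metis
  qed
  have "br xs \<in> I" if xs: "length xs = n" "set xs \<subseteq> S" "i < n" "xs ! i \<in> I" for xs i
  proof (cases "i = n - 1")
    case True
    then show ?thesis using last xs by simp
  next
    case False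
    let ?ys = "xs[i := xs ! (n - 1), n - 1 := xs ! i]"
    have "br ?ys = - br xs"
      using False xs by (intro skew_symmetric) auto
    moreover have "br ?ys \<in> I"
      using xs by (intro last set_update_subset) (auto simp: nth_list_update)
    ultimately show ?thesis using subspace_neg[OF I(1)] by (metis minus_minus)
  qed
  then have "nlie_ideal S I" unfolding nlie_ideal_def using I by blast
  then show ?thesis using simple I(3) by (auto simp: nlie_simple_def)
qed

lemma span_brackets: "span {br xs | xs. length xs = n \<and> set xs \<subseteq> S} = S" (is "?T = S")
proof -
  have sub: "?T \<subseteq> S" using br_closed S_subspace by (intro span_minimal) auto
  have "nlie_ideal S ?T"
    unfolding nlie_ideal_def using sub by (auto intro!: span_base)
  moreover obtain xs where "length xs = n" "set xs \<subseteq> S" "br xs \<noteq> 0"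
    using nonzero_bracket by blast
  then have "br xs \<in> ?T" "br xs \<noteq> 0" by (auto intro!: span_base)
  then have "?T \<noteq> {0}" by blast
  ultimately show ?thesis using simple by (auto simp: nlie_simple_def)
qed

text \<open>On a bracket \<open>v = [xs]\<close> the left side is the size of \<open>\<Sum>\<^sub>i [\<dots>, f x\<^sub>i, \<dots>]\<close>, which is bounded by the size of \<open>f\<close>
  with a constant depending on \<open>xs\<close> only. Such bounds pass to linear combinations. What matters is that
  \<open>C\<close> depends on neither \<open>k\<close> nor \<open>f\<close>.\<close>

lemma scaled_derivation_bounded:
  assumes B: "finite B" "span B = S" and v: "v \<in> S"
  shows "\<exists>C\<ge>0. \<forall>k f. scaled_derivation S k f \<longrightarrow>
    real n ^ k * nrm (f v) \<le> C * (\<Sum>b\<in>B. nrm (f b))"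
proof -
  let ?N = "\<lambda>f. \<Sum>b\<in>B. nrm (f b)"
  have bracket: "\<exists>C\<ge>0. \<forall>k f. scaled_derivation S k f \<longrightarrow> real n ^ k * nrm (f (br xs)) \<le> C * ?N f"
    if xs: "length xs = n" "set xs \<subseteq> S" for xs
  proof -
    have "\<exists>C\<ge>0. \<forall>f. lin f \<longrightarrow> nrm (br (xs[i := f (xs ! i)])) \<le> C * ?N f" if i: "i < n" for i
    proof -
      obtain C where C: "C \<ge> 0" "\<And>v. nrm (br (xs[i := v])) \<le> C * nrm v"
        using lin_bounded[OF multilinear[OF xs(1) i]] by (elim exE conjE) simp
      have "xs ! i \<in> span B" using xs i B by auto
      then obtain C' where C': "C' \<ge> 0" "\<And>f. lin f \<Longrightarrow> nrm (f (xs ! i)) \<le> C' * ?N f"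
        using nrm_bounded_on_span[OF B(1), of "xs ! i"] by meson
      have "nrm (br (xs[i := f (xs ! i)])) \<le> (C * C') * ?N f" if "lin f" for f
        using C(2)[of "f (xs ! i)"] mult_left_mono[OF C'(2)[OF that] C(1)] by (simp add: mult.assoc)
      then show ?thesis using C(1) C'(1) by (intro exI[of _ "C * C'"]) auto
    qed
    then obtain C where C: "\<And>i. i < n \<Longrightarrow> C i \<ge> 0"
      "\<And>i f. i < n \<Longrightarrow> lin f \<Longrightarrow> nrm (br (xs[i := f (xs ! i)])) \<le> C i * ?N f"
      by metis
    have "real n ^ k * nrm (f (br xs)) \<le> (\<Sum>i<n. C i) * ?N f" if f: "scaled_derivation S k f" for k f
    proof -
      have "real n ^ k * nrm (f (br xs)) = nrm ((of_nat n ^ k) *s f (br xs))"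
        by (simp add: nrm_scale norm_power)
      also have "\<dots> \<le> (\<Sum>i<n. nrm (br (xs[i := f (xs ! i)])))"
        unfolding scaled_derivationD(4)[OF f xs] by (rule nrm_sum)
      also have "\<dots> \<le> (\<Sum>i<n. C i * ?N f)"
        using C(2) scaled_derivationD(1)[OF f] by (intro sum_mono) auto
      finally show ?thesis by (simp add: sum_distrib_right)
    qed
    then show ?thesis using C(1) by (intro exI[of _ "\<Sum>i<n. C i"]) (auto intro!: sum_nonneg)
  qed
  from v have "v \<in> span {br xs | xs. length xs = n \<and> set xs \<subseteq> S}" by (simp add: span_brackets)
  then show ?thesis
  proof (induction rule: span_induct_alt)
    case base
    show ?case by (intro exI[of _ 0]) (simp add: scaled_derivation_def lin_0 nrm_0)
  next
    case (step c x y)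
    obtain C1 where C1: "C1 \<ge> 0"
      "\<And>k f. scaled_derivation S k f \<Longrightarrow> real n ^ k * nrm (f x) \<le> C1 * ?N f"
      using bracket step(1) by blast
    obtain C2 where C2: "C2 \<ge> 0"
      "\<And>k f. scaled_derivation S k f \<Longrightarrow> real n ^ k * nrm (f y) \<le> C2 * ?N f"
      using step(2) by blast
    show ?case
    proof (intro exI[of _ "cmod c * C1 + C2"] conjI allI impI)
      show "0 \<le> cmod c * C1 + C2" using C1 C2 by simp
      fix k f assume f: "scaled_derivation S k f"
      have "nrm (f (c *s x + y)) \<le> cmod c * nrm (f x) + nrm (f y)"
        using nrm_add[of "c *s f x" "f y"] scaled_derivationD(1)[OF f]
        by (simp add: lin_add lin_scale nrm_scale)
      then have "real n ^ k * nrm (f (c *s x + y))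
          \<le> real n ^ k * (cmod c * nrm (f x) + nrm (f y))"
        by (intro mult_left_mono) auto
      also have "\<dots> = cmod c * (real n ^ k * nrm (f x)) + real n ^ k * nrm (f y)"
        by (simp add: algebra_simps)
      also have "\<dots> \<le> cmod c * (C1 * ?N f) + C2 * ?N f"
        using C1(2)[OF f] C2(2)[OF f] by (intro add_mono mult_left_mono) auto
      finally show "real n ^ k * nrm (f (c *s x + y)) \<le> (cmod c * C1 + C2) * ?N f"
        by (simp add: algebra_simps)
    qed
  qed
qed

lemma scaled_derivation_large_power:
  "\<exists>k0. \<forall>k\<ge>k0. \<forall>f. scaled_derivation S k f \<longrightarrow> (\<forall>x\<in>S. f x = 0)"
proof -
  obtain B where B: "finite B" "B \<subseteq> S" "span B = S" using basis_subspace_exists[OF S_subspace] .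
  let ?N = "\<lambda>f. \<Sum>b\<in>B. nrm (f b)"
  have "\<forall>b\<in>B. \<exists>C\<ge>0. \<forall>k f. scaled_derivation S k f \<longrightarrow> real n ^ k * nrm (f b) \<le> C * ?N f"
    using scaled_derivation_bounded[OF B(1,3)] B(2) by blast
  then obtain C where C: "\<And>b k f. b \<in> B \<Longrightarrow> scaled_derivation S k f \<Longrightarrow>
      real n ^ k * nrm (f b) \<le> C b * ?N f"
    by metis
  obtain k0 where k0: "sum C B < real n ^ k0"
    using real_arch_pow[of "real n" "sum C B"] n_ge_2 by auto
  show ?thesis
  proof (intro exI[of _ k0] allI impI ballI)
    fix k f x assume k: "k0 \<le> k" and f: "scaled_derivation S k f" and x: "x \<in> S"
    have "real n ^ k * ?N f = (\<Sum>b\<in>B. real n ^ k * nrm (f b))" by (rule sum_distrib_left)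
    also have "\<dots> \<le> (\<Sum>b\<in>B. C b * ?N f)" using C[OF _ f] by (rule sum_mono)
    also have "\<dots> = sum C B * ?N f" by (rule sum_distrib_right[symmetric])
    finally have "real n ^ k * ?N f \<le> sum C B * ?N f" .
    moreover have "sum C B < real n ^ k"
      using k0 power_increasing[OF k, of "real n"] n_ge_2 by linarith
    moreover have "?N f \<ge> 0" by (simp add: sum_nonneg nrm_nonneg)
    ultimately have "?N f = 0"
      by (metis less_eq_real_def mult_right_less_imp_less not_le mult_strict_right_mono)
    then have "\<forall>b\<in>B. f b = 0"
      using B(1) nrm_eq_0 by (simp add: sum_nonneg_eq_0_iff nrm_nonneg)
    then show "f x = 0"
      using lin_vanishes_on_span[OF scaled_derivationD(1)[OF f]] x B(3) by blast
  qed
qed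

text \<open>The scalar \<open>c\<close> turns the defining equation into \<open>n\<^sup>k c [xs] = n c [xs]\<close>, and \<open>n\<^sup>k \<noteq> n\<close>.\<close>

lemma scalar_scaled_derivation_zero:
  assumes f: "scaled_derivation S k f" and k: "2 \<le> k" and c: "\<And>x. x \<in> S \<Longrightarrow> f x = c *s x"
  shows "c = 0"
proof -
  obtain xs where xs: "length xs = n" "set xs \<subseteq> S" "br xs \<noteq> 0" using nonzero_bracket by blast
  have "br (xs[i := f (xs ! i)]) = c *s br xs" if "i < n" for i
  proof -
    have "xs ! i \<in> S" using xs that by auto
    then show ?thesis using lin_scale[OF multilinear[OF xs(1) that], of c "xs ! i"] c by simp
  qed
  then have "(of_nat n ^ k) *s (c *s br xs) = (\<Sum>i<n. c *s br xs)"
    using scaled_derivationD(4)[OF f xs(1,2)] c[OF br_closed[OF xs(1,2)]] by simp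
  also have "\<dots> = of_nat n *s (c *s br xs)" by (simp add: sum_constant_scale)
  finally have "((of_nat n ^ k - of_nat n) * c) *s br xs = 0"
    by (simp add: scale_left_diff_distrib left_diff_distrib)
  then have "(of_nat n ^ k - of_nat n :: complex) * c = 0" using xs(3) by simp
  moreover have "n < n ^ k"
    using power_strict_increasing[of 1 k n] n_ge_2 k by simp
  then have "(of_nat n ^ k - of_nat n :: complex) \<noteq> 0"
    by (metis eq_iff_diff_eq_0 less_irrefl of_nat_eq_iff of_nat_power)
  ultimately show ?thesis by simp
qed

definition scaled_derivations_commute :: "nat \<Rightarrow> bool"
  where "scaled_derivations_commute k \<longleftrightarrow> (\<forall>f g. scaled_derivation S k f \<longrightarrow>
    scaled_derivation S k g \<longrightarrow> (\<forall>x\<in>S. f (g x) = g (f x)))"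

lemma scaled_derivations_commuteD:
  assumes "scaled_derivations_commute k" "scaled_derivation S k f" "scaled_derivation S k g" "x \<in> S"
  shows "f (g x) = g (f x)"
  using assms by (auto simp: scaled_derivations_commute_def)

text \<open>For a derivation \<open>D\<close> the commutator \<open>[f, D]\<close> again lies in the commutative family, so it commutes with
  \<open>f\<close>. By the Leibniz rule \<open>D\<close> then preserves the generalised eigenspace of \<open>f\<close> for \<open>c\<close>, which is therefore
  a nonzero ideal.\<close>

lemma eigenvalue_shift_nilpotent:
  assumes comm: "scaled_derivations_commute k"
    and f: "scaled_derivation S k f" and y: "y \<in> S" "y \<noteq> 0" "f y = c *s y"
  shows "\<exists>M. \<forall>x\<in>S. ((\<lambda>x. f x - c *s x) ^^ M) x = 0"
proof -
  define g where "g = (\<lambda>x. f x - c *s x)"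
  note lf = scaled_derivationD(1)[OF f]
  have lg: "lin g" unfolding g_def using lf by (rule lin_shift)
  have gS: "g ` S \<subseteq> S"
    using scaled_derivationD(3)[OF f] S_subspace
    by (auto simp: g_def intro!: subspace_diff subspace_scale)
  define E where "E = {x \<in> S. \<exists>m. (g ^^ m) x = 0}"
  have E_pad: "(g ^^ m') x = 0" if "(g ^^ m) x = 0" "m \<le> m'" for m m' x
  proof -
    have "(g ^^ m') x = (g ^^ (m' - m)) ((g ^^ m) x)"
      using that(2) by (metis comp_apply funpow_add le_add_diff_inverse2)
    then show ?thesis using that(1) lin_0[OF lin_funpow[OF lg]] by simp
  qed
  have "E = S"
  proof (rule ideal_eq_S)
    show "subspace E"
      unfolding subspace_def
    proof (intro conjI ballI allI)
      show "0 \<in> E" unfolding E_def using subspace_0[OF S_subspace] by (auto intro!: exI[of _ 0])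
      fix x z c assume x: "x \<in> E"
      show "c *s x \<in> E"
        using x subspace_scale[OF S_subspace] by (auto simp: E_def lin_scale[OF lin_funpow[OF lg]])
      assume z: "z \<in> E"
      obtain m1 m2 where m: "(g ^^ m1) x = 0" "(g ^^ m2) z = 0" using x z by (auto simp: E_def)
      have "(g ^^ max m1 m2) (x + z) = 0"
        using E_pad[OF m(1)] E_pad[OF m(2)] by (simp add: lin_add[OF lin_funpow[OF lg]])
      then show "x + z \<in> E"
        using x z subspace_add[OF S_subspace] unfolding E_def by blast
    qed
    show "E \<subseteq> S" by (auto simp: E_def)
    have "(g ^^ 1) y = 0" using y by (simp add: g_def)
    then show "E \<noteq> {0}" using y unfolding E_def by blast
  next
    fix D v assume D: "scaled_derivation S 0 D" and v: "v \<in> E"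
    define C where "C = (\<lambda>x. f (D x) - D (f x))"
    have C: "scaled_derivation S k C"
      unfolding C_def using scaled_derivation_commutator[OF f D S_subspace] by simp
    note lD = scaled_derivationD(1)[OF D] and lC = scaled_derivationD(1)[OF C]
    obtain m where m: "(g ^^ m) v = 0" and vS: "v \<in> S" using v by (auto simp: E_def)
    have "(g ^^ Suc m) (D v) = D ((g ^^ Suc m) v) + of_nat (Suc m) *s C ((g ^^ m) v)"
    proof (rule funpow_commutator[OF lg gS _ _ vS])
      fix x assume x: "x \<in> S"
      show "g (D x) = D (g x) + C x"
        by (simp add: g_def C_def lin_diff[OF lD] lin_scale[OF lD])
      show "g (C x) = C (g x)"
        using scaled_derivations_commuteD[OF comm f C x] by (simp add: g_def lin_diff[OF lC] lin_scale[OF lC])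
    qed
    also have "\<dots> = 0"
      using m lin_0[OF lg] lin_0[OF lD] lin_0[OF lC] by simp
    finally have "\<exists>m. (g ^^ m) (D v) = 0" by blast
    moreover have "D v \<in> S" using scaled_derivationD(3)[OF D] vS by blast
    ultimately show "D v \<in> E" by (simp add: E_def)
  qed
  then have "\<exists>M. \<forall>x\<in>S. (g ^^ M) x = 0"
    by (intro uniformly_nilpotent[OF lg S_subspace]) (auto simp: E_def)
  then show ?thesis by (simp add: g_def)
qed

text \<open>Let \<open>g = f - c\<close> be nilpotent of exact order \<open>m + 1\<close> and \<open>C = [f, D]\<close>. The Leibniz rule for \<open>g\<^bsup>m+1\<^esup> = 0\<close>
  reads \<open>(m + 1) C g\<^sup>m = 0\<close>, so \<open>C\<close> kills the nonzero image of \<open>g\<^sup>m\<close>.\<close>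

lemma commutator_singular:
  assumes comm: "scaled_derivations_commute k"
    and f: "scaled_derivation S k f" and D: "scaled_derivation S 0 D"
  shows "\<exists>y\<in>S. y \<noteq> 0 \<and> f (D y) - D (f y) = 0"
proof -
  define C where "C = (\<lambda>x. f (D x) - D (f x))"
  have C: "scaled_derivation S k C"
    unfolding C_def using scaled_derivation_commutator[OF f D S_subspace] by simp
  note lf = scaled_derivationD(1)[OF f] and lD = scaled_derivationD(1)[OF D]
    and lC = scaled_derivationD(1)[OF C]
  obtain y c where y: "y \<in> S" "y \<noteq> 0" "f y = c *s y"
    using eigenvector_exists[OF lf S_subspace scaled_derivationD(2)[OF f] S_nonzero] by blast
  define g where "g = (\<lambda>x. f x - c *s x)"
  have lg: "lin g" unfolding g_def using lf by (rule lin_shift)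
  have gS: "g ` S \<subseteq> S"
    using scaled_derivationD(3)[OF f] S_subspace
    by (auto simp: g_def intro!: subspace_diff subspace_scale)
  define M where "M = (LEAST M. \<forall>x\<in>S. (g ^^ M) x = 0)"
  have ex: "\<exists>M. \<forall>x\<in>S. (g ^^ M) x = 0"
    unfolding g_def by (rule eigenvalue_shift_nilpotent[OF comm f y])
  have M: "\<forall>x\<in>S. (g ^^ M) x = 0"
    unfolding M_def using ex by (rule LeastI_ex)
  have "M \<noteq> 0" using M y by (metis funpow_0)
  then obtain m where m: "M = Suc m" using not0_implies_Suc by blast
  then have "\<not> (\<forall>x\<in>S. (g ^^ m) x = 0)"
    using not_less_Least[of m "\<lambda>M. \<forall>x\<in>S. (g ^^ M) x = 0"] by (simp add: M_def)
  then obtain x where x: "x \<in> S" "(g ^^ m) x \<noteq> 0" by blast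
  have "(g ^^ Suc m) (D x) = D ((g ^^ Suc m) x) + of_nat (Suc m) *s C ((g ^^ m) x)"
  proof (rule funpow_commutator[OF lg gS _ _ x(1)])
    fix x assume x: "x \<in> S"
    show "g (D x) = D (g x) + C x"
      by (simp add: g_def C_def lin_diff[OF lD] lin_scale[OF lD])
    show "g (C x) = C (g x)"
      using scaled_derivations_commuteD[OF comm f C x] by (simp add: g_def lin_diff[OF lC] lin_scale[OF lC])
  qed
  then have "of_nat (Suc m) *s C ((g ^^ m) x) = 0"
    using M scaled_derivationD(3)[OF D] x(1) lin_0[OF lD] unfolding m by simp
  then have "C ((g ^^ m) x) = 0" by (metis of_nat_neq_0 scale_eq_0_iff)
  then show ?thesis
    using x funpow_invariant[OF gS x(1)] by (auto simp: C_def)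
qed

text \<open>Take a common eigenvector \<open>x\<^sub>0\<close> of the family, and let \<open>J\<close> consist of the vectors on which every member acts
  with the same eigenvalue as on \<open>x\<^sub>0\<close>. A commutator \<open>C = [g, D]\<close> with a derivation is singular, hence
  nilpotent, hence has eigenvalue \<open>0\<close> at \<open>x\<^sub>0\<close> and vanishes on \<open>J\<close>. So \<open>g D = D g\<close> on \<open>J\<close>, which makes \<open>J\<close> a
  nonzero ideal.\<close>

lemma commuting_scaled_derivations_scalar:
  assumes comm: "scaled_derivations_commute k"
    and f: "scaled_derivation S k f"
  shows "\<exists>c. \<forall>x\<in>S. f x = c *s x"
proof -
  have "\<exists>x\<in>S. x \<noteq> 0 \<and> (\<forall>f\<in>Collect (scaled_derivation S k). \<exists>c. f x = c *s x)"
  proof (rule common_eigenvector_exists)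
    show "f (g x) = g (f x)"
      if "f \<in> Collect (scaled_derivation S k)" "g \<in> Collect (scaled_derivation S k)" "x \<in> S" for f g x
      using that by (intro scaled_derivations_commuteD[OF comm]) auto
  qed (auto simp: scaled_derivation_def S_subspace S_nonzero)
  then obtain x0 where x0: "x0 \<in> S" "x0 \<noteq> 0"
    and common: "\<And>g. scaled_derivation S k g \<Longrightarrow> \<exists>c. g x0 = c *s x0" by blast
  define J where "J = {x \<in> S. \<forall>g c. scaled_derivation S k g \<longrightarrow> g x0 = c *s x0 \<longrightarrow> g x = c *s x}"
  have "J = S"
  proof (rule ideal_eq_S)
    show "subspace J"
      unfolding subspace_def J_def using S_subspace
      by (auto simp: subspace_0 subspace_add subspace_scale scaled_derivation_def lin_0 lin_add
          lin_scale scale_right_distrib mult.commute)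
    show "J \<subseteq> S" by (auto simp: J_def)
    have "x0 \<in> J" using x0 by (simp add: J_def)
    then show "J \<noteq> {0}" using x0 by blast
  next
    fix D v assume D: "scaled_derivation S 0 D" and v: "v \<in> J"
    have "g (D v) = c *s D v" if g: "scaled_derivation S k g" and c: "g x0 = c *s x0" for g c
    proof -
      define C where "C = (\<lambda>x. g (D x) - D (g x))"
      have C: "scaled_derivation S k C"
        unfolding C_def using scaled_derivation_commutator[OF g D S_subspace] by simp
      obtain y where y: "y \<in> S" "y \<noteq> 0" "C y = 0"
        using commutator_singular[OF comm g D] unfolding C_def by blast
      \<comment> \<open>the nilpotency criterion at the eigenvalue \<open>0\<close> of \<open>C\<close>\<close>
      then have "C y = 0 *s y" by simp
      then obtain M where M: "\<forall>x\<in>S. ((\<lambda>x. C x - 0 *s x) ^^ M) x = 0"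
        using eigenvalue_shift_nilpotent[OF comm C y(1,2)] by blast
      then have "(C ^^ M) x0 = 0" using x0(1) by simp
      obtain d where d: "C x0 = d *s x0" using common[OF C] by blast
      have "d ^ M *s x0 = 0"
        using funpow_eigenvector[OF scaled_derivationD(1)[OF C] d, of M] \<open>(C ^^ M) x0 = 0\<close> by simp
      then have "d = 0" using x0(2) by simp
      then have "C v = 0" using v C d by (auto simp: J_def)
      then have "g (D v) = D (g v)" by (simp add: C_def)
      moreover have "g v = c *s v" using v g c by (auto simp: J_def)
      ultimately show ?thesis using lin_scale[OF scaled_derivationD(1)[OF D]] by simp
    qed
    moreover have "D v \<in> S" using scaled_derivationD(3)[OF D] v by (auto simp: J_def)
    ultimately show "D v \<in> J" by (simp add: J_def)
  qed
  moreover obtain c where "f x0 = c *s x0" using common[OF f] by blast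
  ultimately show ?thesis using f by (auto simp: J_def)
qed

lemma scaled_derivation_scalar_step:
  assumes scalar: "\<And>f. scaled_derivation S (k + k) f \<Longrightarrow> \<exists>c. \<forall>x\<in>S. f x = c *s x"
    and k: "1 \<le> k" and f: "scaled_derivation S k f"
  shows "\<exists>c. \<forall>x\<in>S. f x = c *s x"
proof (rule commuting_scaled_derivations_scalar[OF _ f])
  show "scaled_derivations_commute k"
    unfolding scaled_derivations_commute_def
  proof (intro allI impI ballI)
    fix f g x assume f: "scaled_derivation S k f" and g: "scaled_derivation S k g" and x: "x \<in> S"
    have C: "scaled_derivation S (k + k) (\<lambda>x. f (g x) - g (f x))"
      by (rule scaled_derivation_commutator[OF f g S_subspace])
    then obtain c where c: "\<forall>x\<in>S. f (g x) - g (f x) = c *s x" using scalar by blast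
    then have "c = 0" using scalar_scaled_derivation_zero[OF C] k by simp
    then show "f (g x) = g (f x)" using c x by simp
  qed
qed

text \<open>Doubling \<open>k\<close> repeatedly leads to the range in which \<open>\<Delta>\<^sub>k\<close> vanishes.\<close>

theorem scaled_derivation_scalar:
  assumes "1 \<le> k" "scaled_derivation S k f"
  shows "\<exists>c. \<forall>x\<in>S. f x = c *s x"
proof -
  obtain k0 where k0: "\<And>k f. k0 \<le> k \<Longrightarrow> scaled_derivation S k f \<Longrightarrow> \<forall>x\<in>S. f x = 0"
    using scaled_derivation_large_power by blast
  show ?thesis
    using assms
  proof (induction "k0 - k" arbitrary: k f rule: less_induct)
    case less
    show ?case
    proof (cases "k0 \<le> k")
      case True
      then show ?thesis using k0 less.prems(2) by (intro exI[of _ 0]) simp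
    next
      case False
      then show ?thesis
        using less.prems by (intro scaled_derivation_scalar_step[of k, OF less.hyps]) auto
    qed
  qed
qed

text \<open>If \<open>x\<close> acts on \<open>S\<close> as a scalar \<open>c \<noteq> 0\<close>, then \<open>c z = x \<cdot> z = z \<cdot> x\<close> is a multiple of \<open>x\<close> for every \<open>z\<close>, so \<open>S\<close>
  is a line. Skew-symmetry in the first two slots then kills the bracket.\<close>

lemma commutative_multiplication_zero:
  assumes deriv: "\<And>w. scaled_derivation S 1 (mul w)"
    and comm: "\<And>x y. mul x y = mul y x"
    and x: "x \<in> S" and y: "y \<in> S"
  shows "mul x y = 0"
proof (rule ccontr)
  assume nz: "mul x y \<noteq> 0"
  have scal: "\<exists>c. \<forall>z\<in>S. mul w z = c *s z" for w
    using scaled_derivation_scalar[OF _ deriv] by simp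
  obtain c where c: "\<And>z. z \<in> S \<Longrightarrow> mul x z = c *s z" using scal by blast
  with nz y have "c \<noteq> 0" by auto
  have line: "\<exists>d. z = d *s x" if z: "z \<in> S" for z
  proof -
    obtain d where "mul z x = d *s x" using scal x by blast
    then have "c *s z = d *s x" using c[OF z] comm by metis
    then have "inverse c *s (c *s z) = inverse c *s (d *s x)" by simp
    then show ?thesis using \<open>c \<noteq> 0\<close> by auto
  qed
  obtain xs where xs: "length xs = n" "set xs \<subseteq> S" "br xs \<noteq> 0" using nonzero_bracket by blast
  have pos: "0 < n" "1 < n" using n_ge_2 by auto
  then have "xs ! 0 \<in> S" "xs ! 1 \<in> S" using xs nth_mem by blast+
  then obtain a b where ab: "xs ! 0 = a *s x" "xs ! 1 = b *s x" using line by blast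
  let ?ys = "xs[0 := x, 1 := x]"
  have ys: "length ?ys = n" using xs by simp
  have "xs = (xs[1 := b *s x])[0 := a *s x]"
    using ab by (metis list_update_id)
  then have "br xs = br (xs[1 := b *s x, 0 := a *s x])" by (rule arg_cong)
  also have "\<dots> = a *s br (xs[1 := b *s x, 0 := x])"
    using lin_scale[OF multilinear[of "xs[1 := b *s x]" 0]] xs(1) pos by simp
  also have "xs[1 := b *s x, 0 := x] = xs[0 := x, 1 := b *s x]"
    by (simp add: list_update_swap)
  also have "br (xs[0 := x, 1 := b *s x]) = b *s br ?ys"
    using lin_scale[OF multilinear[of "xs[0 := x]" 1]] xs(1) pos by simp
  finally have "br ?ys \<noteq> 0" using xs(3) by auto
  have "?ys[0 := ?ys ! 1, 1 := ?ys ! 0] = ?ys"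
    using xs(1) pos by (intro nth_equalityI) (auto simp: nth_list_update)
  then have "br ?ys = - br ?ys"
    using skew_symmetric[OF ys, of 0 1] pos by simp
  then have "br ?ys + br ?ys = 0" by (metis add.right_inverse)
  then have "2 *s br ?ys = 0" using scale_left_distrib[of 1 1 "br ?ys"] by simp
  with \<open>br ?ys \<noteq> 0\<close> show False by simp
qed

end

section \<open>Semisimple algebras\<close>

context fd_n_lie_algebra
begin

lemma simple_ideal_subalgebra:
  assumes "nlie_ideal UNIV S" "nlie_simple S"
  shows "simple_subalgebra scale n br Basis S"
proof (unfold_locales)
  show "subspace S" using assms(1) by (simp add: nlie_ideal_def)
  show "nlie_simple S" by fact
  fix xs :: "'a list" assume xs: "length xs = n" "set xs \<subseteq> S"
  moreover have "0 < n" using n_ge_2 by simp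
  ultimately have "xs ! 0 \<in> S" using nth_mem by blast
  then show "br xs \<in> S" using assms(1) xs(1) \<open>0 < n\<close> unfolding nlie_ideal_def by blast
qed

text \<open>What needs an argument is that \<open>w \<cdot> v\<close> stays in the summand. For a bracket \<open>v\<close> of elements of \<open>S\<close>, each term
  of \<open>\<Sum>\<^sub>i [\<dots>, w \<cdot> x\<^sub>i, \<dots>]\<close> has another entry in the ideal \<open>S\<close>, as \<open>n \<ge> 2\<close>; and these brackets span \<open>S\<close>.\<close>

lemma multiplication_scaled_derivation:
  assumes tp: "transposed_poisson mul" and S: "nlie_ideal UNIV S" "nlie_simple S"
  shows "scaled_derivation S 1 (mul w)"
proof -
  interpret simple_subalgebra scale n br Basis S by (rule simple_ideal_subalgebra[OF S])
  have lin: "lin (mul w)" using tp by (simp add: transposed_poisson_def)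
  have eq: "of_nat n *s mul w (br xs) = (\<Sum>i<n. br (xs[i := mul w (xs ! i)]))" if "length xs = n" for xs
    using tp that by (simp add: transposed_poisson_def)
  have bracket: "mul w (br xs) \<in> S" if xs: "length xs = n" "set xs \<subseteq> S" for xs
  proof -
    have "br (xs[i := mul w (xs ! i)]) \<in> S" if i: "i < n" for i
    proof -
      define j :: nat where "j = (if i = 0 then 1 else 0)"
      have j: "j < n" "i \<noteq> j" using n_ge_2 by (auto simp: j_def)
      then have "xs[i := mul w (xs ! i)] ! j \<in> S" using xs by auto
      then show ?thesis using S(1) j(1) xs(1) unfolding nlie_ideal_def
        by (metis length_list_update subset_UNIV)
    qed
    then have "of_nat n *s mul w (br xs) \<in> S"
      unfolding eq[OF xs(1)] by (intro subspace_sum[OF S_subspace]) auto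
    then have "inverse (of_nat n) *s (of_nat n *s mul w (br xs)) \<in> S"
      by (rule subspace_scale[OF S_subspace])
    then show ?thesis using n_ge_2 by simp
  qed
  have "mul w v \<in> S" if "v \<in> S" for v
  proof -
    have "v \<in> span {br xs | xs. length xs = n \<and> set xs \<subseteq> S}" using that by (simp add: span_brackets)
    then show ?thesis
      by (induction rule: span_induct_alt)
        (auto simp: lin_0[OF lin] lin_add[OF lin] lin_scale[OF lin] subspace_0[OF S_subspace]
          intro!: subspace_add[OF S_subspace] subspace_scale[OF S_subspace] bracket)
  qed
  then show ?thesis using lin eq by (auto simp: scaled_derivation_def)
qed

lemma semisimple_transposed_poisson_zero:
  assumes ss: nlie_semisimple and tp: "transposed_poisson mul"
  shows "mul x y = 0"
proof -
  obtain m :: nat and S where S: "\<And>k. k < m \<Longrightarrow> nlie_ideal UNIV (S k) \<and> nlie_simple (S k)"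
    and decomp: "\<And>v. \<exists>!f. f \<in> (\<Pi>\<^sub>E k\<in>{..<m}. S k) \<and> v = (\<Sum>k<m. f k)"
    using ss unfolding nlie_semisimple_def by blast
  have linl: "lin (\<lambda>x. mul x y)" and linr: "lin (mul x)" and comm: "mul x y = mul y x" for x y
    using tp by (simp_all add: transposed_poisson_def)
  have sub: "subspace (S k)" if "k < m" for k using S[OF that] by (simp add: nlie_ideal_def)
  have inv: "mul w v \<in> S k" if "k < m" "v \<in> S k" for w v k
    using scaled_derivationD(3)[OF multiplication_scaled_derivation[OF tp]] S that by blast
  have disjoint: "v = 0" if jk: "j < m" "k < m" "j \<noteq> k" and v: "v \<in> S j" "v \<in> S k" for v j k
  proof -
    \<comment> \<open>placing \<open>v\<close> in the component \<open>j\<close> or in \<open>k\<close> gives two decompositions of \<open>v\<close>\<close>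
    define F where "F l = (\<lambda>i\<in>{..<m}. if i = l then v else 0)" for l
    have "F l \<in> (\<Pi>\<^sub>E k\<in>{..<m}. S k) \<and> v = (\<Sum>k<m. F l k)" if "l < m" "v \<in> S l" for l
      using that subspace_0[OF sub] by (auto simp: F_def)
    then have "F j = F k" using decomp[of v] jk v by blast
    then have "F j j = F k j" by simp
    then show "v = 0" using jk by (simp add: F_def)
  qed
  have zero: "mul u v = 0" if u: "j < m" "u \<in> S j" and v: "k < m" "v \<in> S k" for u v j k
  proof (cases "j = k")
    case True
    interpret simple_subalgebra scale n br Basis "S k"
      using S[OF v(1)] by (intro simple_ideal_subalgebra) auto
    show ?thesis
      using commutative_multiplication_zero[OF multiplication_scaled_derivation[OF tp] comm]
        S[OF v(1)] u v True by blast
  next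
    case False
    have "mul u v \<in> S k" "mul v u \<in> S j" using inv u v by blast+
    then show ?thesis using disjoint[OF u(1) v(1) False] comm[of u v] by simp
  qed
  obtain a where a: "a \<in> (\<Pi>\<^sub>E k\<in>{..<m}. S k)" "x = (\<Sum>k<m. a k)" using decomp[of x] by blast
  obtain b where b: "b \<in> (\<Pi>\<^sub>E k\<in>{..<m}. S k)" "y = (\<Sum>k<m. b k)" using decomp[of y] by blast
  have "mul x y = (\<Sum>k<m. \<Sum>j<m. mul (a j) (b k))"
    by (simp add: a(2) b(2) lin_sum[OF linl] lin_sum[OF linr])
  also have "\<dots> = 0" using a(1) b(1) zero by (intro sum.neutral ballI) (auto simp: PiE_iff)
  finally show ?thesis .
qed

end

theorem corollary17:
  fixes n :: nat
    and scale :: "complex \<Rightarrow> 'a::ab_group_add \<Rightarrow> 'a"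
    and br :: "'a list \<Rightarrow> 'a"
  assumes "n \<ge> 2"
    and "n_lie_algebra scale n br"
    and "\<exists>B. finite_dimensional_vector_space scale B"
    and "n_lie_algebra.nlie_semisimple scale n br"
  shows "\<not> (\<exists>mul. n_lie_algebra.transposed_poisson scale n br mul \<and>
                  n_lie_algebra.nontrivial_structure n br mul)"
proof -
  obtain B where "finite_dimensional_vector_space scale B" using assms(3) by blast
  then have "fd_n_lie_algebra scale n br B"
    using assms(1,2) by (intro fd_n_lie_algebra.intro complex_fd_space.intro fd_n_lie_algebra_axioms.intro)
  then interpret fd_n_lie_algebra scale n br B .
  show ?thesis
    using semisimple_transposed_poisson_zero[OF assms(4)] by (auto simp: nontrivial_structure_def)
qed

end
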